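(* Let $G$ be a graph and $H$ a $c$-degenerate graph, both on $n$ vertices. Let $d_1^{(G)}\geq d_2^{(G)}\geq\dotsb\geq d_n^{(G)}$ be the degree sequence of $G$ and $d_1^{(H)}\geq d_2^{(H)}\geq\dotsb\geq d_n^{(H)}$ the degree sequence of $H$. If \[ \sum_{i=1}^{\Delta(G)} d_i^{(H)}+\sum_{j=1}^{c} d_j^{(G)}<n, \] then $G$ and $H$ pack.
   Context: All graphs are finite and simple. $\Delta(G)$ is the maximum degree of $G$. A graph $H$ is $c$-degenerate if every nonempty subgraph of $H$ has a vertex of degree at most $c$. Two graphs $G$ and $H$ on $n$ vertices pack if there is a bijection $f:V(G)\to V(H)$ such that for every edge $uv\in E(G)$, $f(u)f(v)\notin E(H)$. *)

theory Defs
  imports Main "HOL-Library.Multiset"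
begin

record 'a sgraph =
  sverts :: "'a set"
  sedges :: "'a set set"

definition simple_graph :: "'a sgraph \<Rightarrow> bool" where
  "simple_graph G \<longleftrightarrow>
     finite (sverts G) \<and> (\<forall>e\<in>sedges G. e \<subseteq> sverts G \<and> card e = 2)"

definition vdegree :: "'a sgraph \<Rightarrow> 'a \<Rightarrow> nat" where
  "vdegree G v = card {e \<in> sedges G. v \<in> e}"

text \<open>The value is only meaningful for graphs with at least one vertex.\<close>

definition max_degree :: "'a sgraph \<Rightarrow> nat" where
  "max_degree G = Max (vdegree G ` sverts G)"

definition subgraph_of :: "'a sgraph \<Rightarrow> 'a sgraph \<Rightarrow> bool" where
  "subgraph_of K H \<longleftrightarrow>
     simple_graph K \<and> sverts K \<subseteq> sverts H \<and> sedges K \<subseteq> sedges H"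

definition degenerate :: "nat \<Rightarrow> 'a sgraph \<Rightarrow> bool" where
  "degenerate c H \<longleftrightarrow>
     (\<forall>K. subgraph_of K H \<and> sverts K \<noteq> {} \<longrightarrow> (\<exists>v\<in>sverts K. vdegree K v \<le> c))"

definition degree_list :: "'a sgraph \<Rightarrow> nat list" where
  "degree_list G =
     rev (sorted_list_of_multiset (image_mset (vdegree G) (mset_set (sverts G))))"

text \<open>
  Indices start at 1, so \<open>deg_seq G 1\<close> is the largest degree. Indices beyond the number of
  vertices get the value 0, so a sum of the first \<open>c\<close> degrees with \<open>c\<close> larger than the
  number of vertices is the sum of all degrees.
\<close>

definition deg_seq :: "'a sgraph \<Rightarrow> nat \<Rightarrow> nat" where
  "deg_seq G i = (if 1 \<le> i \<and> i \<le> card (sverts G) then degree_list G ! (i - 1) else 0)"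

definition packs :: "'a sgraph \<Rightarrow> 'b sgraph \<Rightarrow> bool" where
  "packs G H \<longleftrightarrow>
     (\<exists>f. bij_betw f (sverts G) (sverts H) \<and>
          (\<forall>u v. {u, v} \<in> sedges G \<longrightarrow> {f u, f v} \<notin> sedges H))"

lemma mset_degree_list:
  "mset (degree_list G) = image_mset (vdegree G) (mset_set (sverts G))"
  by (simp add: degree_list_def)

lemma length_degree_list: "length (degree_list G) = card (sverts G)"
  by (metis mset_degree_list size_image_mset size_mset size_mset_set)

lemma deg_seq_antimono:
  assumes "1 \<le> i" "i \<le> j"
  shows "deg_seq G j \<le> deg_seq G i"
proof (cases "j \<le> card (sverts G)")
  case True
  have "sorted_wrt (\<ge>) (degree_list G)"
    by (simp add: degree_list_def sorted_wrt_rev)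
  then have "degree_list G ! (j - 1) \<le> degree_list G ! (i - 1)"
    using assms True length_degree_list[of G]
    by (cases "i = j") (auto simp: sorted_wrt_iff_nth_less)
  then show ?thesis
    using assms True by (simp add: deg_seq_def)
qed (simp add: deg_seq_def)

end

theory Submission
  imports Defs "HOL-Combinatorics.Transposition"
begin

text \<open>
  Build a bijection from \<open>H\<close> to \<open>G\<close> that avoids conflicts on a growing vertex set \<open>S\<close> of \<open>H\<close>.
  By degeneracy \<open>S\<close> has a vertex \<open>v\<close> with at most \<open>c\<close> neighbours in \<open>S\<close>; take a bijection \<open>f\<close>
  without conflicts on \<open>S - {v}\<close>. If \<open>f\<close> has a conflict at \<open>v\<close>, exchange the images of \<open>v\<close>
  and some \<open>w\<close>. A bad \<open>w\<close> is reached from \<open>v\<close> by an edge of \<open>H\<close> followed by an edge of \<open>G\<close>, or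
  by an edge of \<open>G\<close> followed by an edge of \<open>H\<close>, and the hypothesis says that there are fewer than
  \<open>n\<close> such walks. The vertices \<open>w\<close> adjacent to \<open>v\<close> in both graphs are bad too, but each of them
  can be charged to the walk that goes to \<open>w\<close> in \<open>H\<close> and back to \<open>v\<close> in \<open>G\<close>.
\<close>

definition neighbours :: "'a sgraph \<Rightarrow> 'a \<Rightarrow> 'a set" where
  "neighbours G v = {w. {v, w} \<in> sedges G}"

lemma simple_graph_edgeD:
  assumes "simple_graph G" "{u, v} \<in> sedges G"
  shows "u \<in> sverts G" "v \<in> sverts G" "u \<noteq> v"
  using assms by (force simp: simple_graph_def)+

lemma neighbours_subset: "simple_graph G \<Longrightarrow> neighbours G v \<subseteq> sverts G"
  by (auto simp: neighbours_def dest: simple_graph_edgeD)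

lemma finite_neighbours: "simple_graph G \<Longrightarrow> finite (neighbours G v)"
  using neighbours_subset[of G v] by (auto simp: simple_graph_def dest: finite_subset)

lemma card_neighbours:
  assumes "simple_graph G"
  shows "card (neighbours G v) = vdegree G v"
proof -
  have "bij_betw (\<lambda>w. {v, w}) (neighbours G v) {e \<in> sedges G. v \<in> e}"
    unfolding bij_betw_def
  proof
    show "inj_on (\<lambda>w. {v, w}) (neighbours G v)"
      by (auto simp: inj_on_def doubleton_eq_iff)
    have "e \<in> (\<lambda>w. {v, w}) ` neighbours G v" if "e \<in> sedges G" "v \<in> e" for e
    proof -
      have "card e = 2" using assms that by (simp add: simple_graph_def)
      then obtain w where "e = {v, w}" using \<open>v \<in> e\<close> by (auto simp: card_2_iff)
      then show ?thesis using \<open>e \<in> sedges G\<close> by (auto simp: neighbours_def)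
    qed
    then show "(\<lambda>w. {v, w}) ` neighbours G v = {e \<in> sedges G. v \<in> e}"
      by (auto simp: neighbours_def)
  qed
  then show ?thesis
    unfolding vdegree_def by (rule bij_betw_same_card)
qed

lemma vdegree_le_max_degree:
  assumes "simple_graph G" "v \<in> sverts G"
  shows "vdegree G v \<le> max_degree G"
  using assms by (simp add: max_degree_def simple_graph_def)

text \<open>Induct on \<open>xs\<close>, matching its largest entry \<open>x\<close> with one
  element removed from \<open>M\<close>.\<close>

lemma sum_mset_le_sum_list_take:
  fixes xs :: "nat list"
  assumes "sorted_wrt (\<ge>) xs" "M \<subseteq># mset xs" "size M \<le> k"
  shows "sum_mset M \<le> sum_list (take k xs)"
  using assms
proof (induction xs arbitrary: M k)
  case Nil
  then show ?case by simp
next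
  case (Cons x xs)
  show ?case
  proof (cases "M = {#}")
    case False
    \<comment> \<open>Removing \<open>x\<close> itself whenever it lies in \<open>M\<close> leaves a
      remainder inside \<open>mset xs\<close>.\<close>
    then obtain y where y: "y \<in># M" "x \<in># M \<Longrightarrow> y = x" by (metis multiset_nonemptyE)
    have "y \<in># mset (x # xs)" using Cons.prems(2) y(1) by (rule mset_subset_eqD)
    then have yx: "y \<le> x" using Cons.prems(1) by auto
    have "M - {#y#} \<subseteq># mset xs"
    proof (cases "x \<in># M")
      case True
      then show ?thesis using Cons.prems(2) y by (simp add: subset_eq_diff_conv)
    next
      case False
      have "count M a \<le> count (mset xs) a" for a
        using mset_subset_eq_count[OF Cons.prems(2), of a] False
        by (cases "a = x") (auto simp: not_in_iff)
      then have "M \<subseteq># mset xs" by (simp add: subseteq_mset_def)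
      then show ?thesis by (meson diff_subset_eq_self subset_mset.order_trans)
    qed
    moreover obtain k' where k: "k = Suc k'"
      using False Cons.prems(3) by (cases k) auto
    moreover have M: "M = add_mset y (M - {#y#})" using y(1) by simp
    moreover have "size (M - {#y#}) \<le> k'"
      using Cons.prems(3) k by (subst (asm) M) simp
    ultimately have "sum_mset (M - {#y#}) \<le> sum_list (take k' xs)"
      using Cons.IH Cons.prems(1) by simp
    then show ?thesis using yx k by (subst M) simp
  qed simp
qed

text \<open>Past the end of the list \<open>take\<close> adds nothing, which agrees with the default
  value 0 of \<open>deg_seq\<close>; so \<open>k\<close> may exceed the number of vertices.\<close>

lemma sum_deg_seq: "(\<Sum>i=1..k. deg_seq G i) = sum_list (take k (degree_list G))"
proof (induction k)
  case (Suc k)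
  then show ?case
    by (cases "k < card (sverts G)")
      (simp_all add: deg_seq_def length_degree_list take_Suc_conv_app_nth)
qed simp

text \<open>Used to count walks by their middle vertices, which form the set
  \<open>S\<close>.\<close>

lemma sum_vdegree_le_sum_deg_seq:
  assumes "finite (sverts G)" "S \<subseteq> sverts G" "card S \<le> k"
  shows "(\<Sum>v\<in>S. vdegree G v) \<le> (\<Sum>i=1..k. deg_seq G i)"
proof -
  have "sorted_wrt (\<ge>) (degree_list G)"
    by (simp add: degree_list_def sorted_wrt_rev)
  moreover have "image_mset (vdegree G) (mset_set S) \<subseteq># mset (degree_list G)"
    unfolding mset_degree_list
    using assms by (intro image_mset_subseteq_mono subset_imp_msubset_mset_set)
  ultimately show ?thesis
    using assms(3) unfolding sum_deg_seq sum_unfold_sum_mset[of _ S]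
    by (intro sum_mset_le_sum_list_take) auto
qed

text \<open>The map goes from \<open>H\<close> to \<open>G\<close>, opposite to
  \<open>packs\<close>, because the induction runs over vertex sets of \<open>H\<close>.\<close>

definition conflict_free :: "'a sgraph \<Rightarrow> 'b sgraph \<Rightarrow> ('a \<Rightarrow> 'b) \<Rightarrow> 'a set \<Rightarrow> bool" where
  "conflict_free H G f S \<longleftrightarrow>
     (\<forall>x\<in>S. \<forall>y\<in>S. {x, y} \<in> sedges H \<longrightarrow> {f x, f y} \<notin> sedges G)"

text \<open>The exchange partner \<open>w\<close> may lie outside \<open>S\<close>, so the bad
  vertices are counted against all of \<open>H\<close>.\<close>

lemma conflict_free_extend:
  assumes G: "simple_graph G" and H: "simple_graph H"
    and f: "bij_betw f (sverts H) (sverts G)"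
    and S: "S \<subseteq> sverts H" "v \<in> S" and free: "conflict_free H G f (S - {v})"
    and c: "card (neighbours H v \<inter> S) \<le> c"
    and bound: "(\<Sum>i=1..max_degree G. deg_seq H i) + (\<Sum>j=1..c. deg_seq G j) < card (sverts H)"
  shows "\<exists>g. bij_betw g (sverts H) (sverts G) \<and> conflict_free H G g S"
proof (cases "\<exists>u\<in>neighbours H v \<inter> S. {f v, f u} \<in> sedges G")
  case False
  then have "conflict_free H G f S"
    using free by (fastforce simp: conflict_free_def neighbours_def insert_commute)
  with f show ?thesis by blast
next
  case True
  define D where "D = neighbours H v \<inter> S"
  define h where "h = inv_into (sverts H) f"
  have hf: "h (f x) = x" if "x \<in> sverts H" for x
    using f that by (simp add: h_def bij_betw_inv_into_left)
  have finD: "finite D" using finite_neighbours[OF H] by (simp add: D_def)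
  have DH: "D \<subseteq> sverts H" using S by (auto simp: D_def)
  have inj: "inj_on f (sverts H)" and im: "f ` sverts H = sverts G"
    using f by (auto simp: bij_betw_def)
  have v: "v \<in> sverts H" using S by auto
  txt \<open>Here a walk from \<open>v\<close> to \<open>u\<close> and back to \<open>v\<close> is made to account for \<open>u\<close> instead of \<open>v\<close>;
    the vertex \<open>v\<close> itself is covered by \<open>B2\<close>.\<close>
  define B1 where "B1 = (\<Union>u\<in>D. (\<lambda>x. if x = f v then u else h x) ` neighbours G (f u))"
  define B2 where "B2 = (\<Union>x\<in>neighbours G (f v). neighbours H (h x))"
  have "card B1 \<le> (\<Sum>u\<in>D. card ((\<lambda>x. if x = f v then u else h x) ` neighbours G (f u)))"
    unfolding B1_def using finD by (rule card_UN_le)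
  also have "\<dots> \<le> (\<Sum>u\<in>D. card (neighbours G (f u)))"
    by (intro sum_mono card_image_le finite_neighbours G)
  also have "\<dots> = (\<Sum>x\<in>f ` D. vdegree G x)"
    using inj_on_subset[OF inj DH] by (simp add: sum.reindex card_neighbours[OF G])
  also have "\<dots> \<le> (\<Sum>j=1..c. deg_seq G j)"
  proof (rule sum_vdegree_le_sum_deg_seq)
    show "finite (sverts G)" using G by (simp add: simple_graph_def)
    show "f ` D \<subseteq> sverts G" using DH im by auto
    show "card (f ` D) \<le> c" using c card_image_le[OF finD, of f] by (simp add: D_def)
  qed
  finally have B1: "card B1 \<le> (\<Sum>j=1..c. deg_seq G j)" .
  have hG: "h ` neighbours G (f v) \<subseteq> sverts H" "inj_on h (neighbours G (f v))"
    using neighbours_subset[OF G, of "f v"] im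
    by (auto simp: h_def intro!: inv_into_into inj_on_inv_into)
  have "card B2 \<le> (\<Sum>x\<in>neighbours G (f v). card (neighbours H (h x)))"
    unfolding B2_def by (intro card_UN_le finite_neighbours G)
  also have "\<dots> = (\<Sum>y\<in>h ` neighbours G (f v). vdegree H y)"
    using hG(2) by (simp add: sum.reindex card_neighbours[OF H])
  also have "\<dots> \<le> (\<Sum>i=1..max_degree G. deg_seq H i)"
  proof (rule sum_vdegree_le_sum_deg_seq)
    show "finite (sverts H)" using H by (simp add: simple_graph_def)
    have "card (neighbours G (f v)) \<le> max_degree G"
      using v im by (auto simp: card_neighbours[OF G] intro: vdegree_le_max_degree[OF G])
    then show "card (h ` neighbours G (f v)) \<le> max_degree G"
      using hG(2) by (simp add: card_image)
  qed (fact hG(1))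
  finally have "card (B1 \<union> B2) < card (sverts H)"
    using B1 bound card_Un_le[of B1 B2] by linarith
  moreover have "finite (B1 \<union> B2)"
    by (auto simp: B1_def B2_def finD finite_neighbours G H)
  ultimately obtain w where w: "w \<in> sverts H" "w \<notin> B1" "w \<notin> B2"
    by (metis UnI1 UnI2 card_mono linorder_not_less subsetI)
  \<comment> \<open>An edge from \<open>f v\<close> to \<open>f u\<close> would put
    \<open>w\<close>, a neighbour of \<open>u = h (f u)\<close>, into \<open>B2\<close>.\<close>
  have wH: "{f v, f u} \<notin> sedges G" if "{w, u} \<in> sedges H" for u
    using w(3) that hf[of u] simple_graph_edgeD(2)[OF H that]
    by (force simp: B2_def neighbours_def insert_commute)
  then have wv: "w \<noteq> v"
    using True by (auto simp: neighbours_def)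
  then have fwv: "f w \<noteq> f v"
    using inj w(1) v by (auto dest: inj_onD)
  \<comment> \<open>Since \<open>f w\<close> is not \<open>f v\<close>, an edge from
    \<open>f u\<close> to \<open>f w\<close> would put \<open>h (f w) = w\<close> into
    \<open>B1\<close>.\<close>
  have wG: "{f w, f u} \<notin> sedges G" if "u \<in> D" for u
    using w(1,2) that hf[of w] fwv
    by (force simp: B1_def neighbours_def insert_commute)
  \<comment> \<open>The exchange preserves the pair \<open>{f v, f w}\<close>, so an edge
    \<open>{v, w}\<close> of \<open>H\<close> needs its own argument: the redirected walk with
    \<open>u = w\<close> would put \<open>w\<close> into \<open>B1\<close>.\<close>
  have ww: "{f w, f v} \<notin> sedges G" if "w \<in> D"
    using w(2) that by (force simp: B1_def neighbours_def)
  define g where "g = f \<circ> transpose v w"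
  have gv: "g v = f w" and gw: "g w = f v" and gu: "\<And>u. u \<noteq> v \<Longrightarrow> u \<noteq> w \<Longrightarrow> g u = f u"
    by (simp_all add: g_def)
  have bij_g: "bij_betw g (sverts H) (sverts G)"
    unfolding g_def using f v w(1) by (intro bij_betw_trans[OF _ f]) simp
  have v_ok: "{g v, g y} \<notin> sedges G" if "y \<in> S" "{v, y} \<in> sedges H" for y
    using wG[of y] ww that gv gw gu[of y] simple_graph_edgeD(3)[OF H that(2)]
    by (cases "y = w") (auto simp: D_def neighbours_def)
  have w_ok: "{g w, g y} \<notin> sedges G" if "{w, y} \<in> sedges H" "y \<noteq> v" for y
    using wH[OF that(1)] that gw gu[of y] simple_graph_edgeD(3)[OF H that(1)] by simp
  have "{g x, g y} \<notin> sedges G" if xy: "x \<in> S" "y \<in> S" "{x, y} \<in> sedges H" for x y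
  proof -
    consider "x = v" | "y = v" | "x = w" "y \<noteq> v" | "y = w" "x \<noteq> v"
      | "x \<notin> {v, w}" "y \<notin> {v, w}" by blast
    then show ?thesis
    proof cases
      case 5
      then show ?thesis using free xy gu by (auto simp: conflict_free_def)
    qed (use xy v_ok[of x] v_ok[of y] w_ok[of x] w_ok[of y] in \<open>auto simp: insert_commute\<close>)
  qed
  with bij_g show ?thesis
    by (auto simp: conflict_free_def)
qed

text \<open>Apply degeneracy to the subgraph induced on \<open>S\<close>, where degrees count
  neighbours within \<open>S\<close>.\<close>

lemma degenerate_obtains_vertex:
  assumes H: "simple_graph H" and "degenerate c H" "S \<subseteq> sverts H" "S \<noteq> {}"
  obtains v where "v \<in> S" "card (neighbours H v \<inter> S) \<le> c"
proof -
  define K where "K = \<lparr>sverts = S, sedges = {e \<in> sedges H. e \<subseteq> S}\<rparr>"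
  have K: "simple_graph K"
    using H assms(3) by (auto simp: K_def simple_graph_def dest: finite_subset)
  then have "subgraph_of K H" using assms(3) by (auto simp: K_def subgraph_of_def)
  moreover have "sverts K = S" by (simp add: K_def)
  ultimately obtain v where v: "v \<in> S" "vdegree K v \<le> c"
    using assms(2,4) unfolding degenerate_def by blast
  moreover have "neighbours K v = neighbours H v \<inter> S"
    using v(1) by (auto simp: neighbours_def K_def)
  ultimately show thesis
    using that card_neighbours[OF K, of v] by simp
qed

theorem theorem1p6:
  fixes G :: "'a sgraph" and H :: "'b sgraph" and n c :: nat
  assumes "simple_graph G" and "card (sverts G) = n"
    and "simple_graph H" and "card (sverts H) = n"
    and "degenerate c H"
    and "(\<Sum>i=1..max_degree G. deg_seq H i) + (\<Sum>j=1..c. deg_seq G j) < n"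
  shows "packs G H"
proof -
  have fin: "finite (sverts G)" "finite (sverts H)"
    using assms(1,3) by (simp_all add: simple_graph_def)
  \<comment> \<open>Induction over proper subsets fits, as degeneracy dictates which vertex is
    removed from \<open>S\<close>.\<close>
  have "\<exists>f. bij_betw f (sverts H) (sverts G) \<and> conflict_free H G f S"
    if "S \<subseteq> sverts H" for S
    using finite_subset[OF that fin(2)] that
  proof (induction S rule: finite_psubset_induct)
    case (psubset S)
    show ?case
    proof (cases "S = {}")
      case True
      then show ?thesis
        using finite_same_card_bij[OF fin(2,1)] assms(2,4) by (auto simp: conflict_free_def)
    next
      case False
      then obtain v where v: "v \<in> S" "card (neighbours H v \<inter> S) \<le> c"
        using degenerate_obtains_vertex[OF assms(3,5) psubset.prems] by blast
      then obtain f where "bij_betw f (sverts H) (sverts G)" "conflict_free H G f (S - {v})"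
        using psubset.IH[of "S - {v}"] psubset.prems by blast
      then show ?thesis
        using conflict_free_extend[OF assms(1,3)] psubset.prems v assms(4,6) by blast
    qed
  qed
  then obtain f where f: "bij_betw f (sverts H) (sverts G)" "conflict_free H G f (sverts H)"
    by blast
  \<comment> \<open>The inverse map has the direction that \<open>packs\<close> asks for.\<close>
  define g where "g = inv_into (sverts H) f"
  have g: "bij_betw g (sverts G) (sverts H)"
    unfolding g_def using f(1) by (rule bij_betw_inv_into)
  have "{g u, g v} \<notin> sedges H" if uv: "{u, v} \<in> sedges G" for u v
  proof -
    have "u \<in> sverts G" "v \<in> sverts G" using simple_graph_edgeD[OF assms(1) uv] by auto
    then have "f (g u) = u" "f (g v) = v" "g u \<in> sverts H" "g v \<in> sverts H"
      using f(1) g by (auto simp: g_def bij_betw_inv_into_right dest: bij_betwE)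
    then show ?thesis using f(2) uv unfolding conflict_free_def by metis
  qed
  with g show ?thesis by (auto simp: packs_def)
qed

end
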